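(* Let $C$ be a cycle of goods and $N=\{1,2,3\}$ a set of three agents with arbitrary utility functions on $C$. Then there exists a $\frac56$-sufficient allocation of the goods of $C$ to the agents in $N$.
   Context: A cycle of goods has goods $v_1,\dots,v_m$ with edges $v_iv_{i+1}$ and $v_mv_1$. A utility function assigns a non-negative real to each good, extended additively to sets. A bundle is a set of goods inducing a connected subgraph (empty allowed); an $n$-split is a sequence of $n$ pairwise disjoint bundles (possibly empty) with union all goods. $\mathrm{mms}^{(n)}(C,u)=\max_{P_1,\dots,P_n}\min_i u(P_i)$ over all $n$-splits. An allocation to agents $1,\dots,n$ with utilities $u_1,\dots,u_n$ is an $n$-split $P_1,\dots,P_n$ with $P_i$ given to agent $i$; for $c>0$ it is $c$-sufficient if $u_i(P_i)\ge c\cdot\mathrm{mms}^{(n)}(C,u_i)$ for all $i$. *)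

theory Defs
  imports Complex_Main
begin

definition cycle_adj :: "nat \<Rightarrow> nat \<Rightarrow> nat \<Rightarrow> bool" where
  "cycle_adj m i j \<longleftrightarrow> i < m \<and> j < m \<and> (j = Suc i mod m \<or> i = Suc j mod m)"

text \<open>A bundle: a set of goods inducing a connected subgraph (empty allowed).\<close>

definition is_bundle :: "nat \<Rightarrow> nat set \<Rightarrow> bool" where
  "is_bundle m S \<longleftrightarrow> S \<subseteq> {..<m} \<and>
     (\<forall>x\<in>S. \<forall>y\<in>S. rtranclp (\<lambda>a b. a \<in> S \<and> b \<in> S \<and> cycle_adj m a b) x y)"

definition n_split :: "nat \<Rightarrow> nat \<Rightarrow> (nat \<Rightarrow> nat set) \<Rightarrow> bool" where
  "n_split n m P \<longleftrightarrow> (\<forall>i<n. is_bundle m (P i)) \<and>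
     (\<forall>i<n. \<forall>j<n. i \<noteq> j \<longrightarrow> P i \<inter> P j = {}) \<and>
     (\<Union>i<n. P i) = {..<m}"

definition mms :: "nat \<Rightarrow> nat \<Rightarrow> (nat \<Rightarrow> real) \<Rightarrow> real" where
  "mms n m u = Sup {Min ((\<lambda>i. sum u (P i)) ` {..<n}) | P. n_split n m P}"

definition sufficient :: "real \<Rightarrow> nat \<Rightarrow> nat \<Rightarrow> (nat \<Rightarrow> nat \<Rightarrow> real) \<Rightarrow> (nat \<Rightarrow> nat set) \<Rightarrow> bool" where
  "sufficient c n m u P \<longleftrightarrow> n_split n m P \<and>
     (\<forall>i<n. sum (u i) (P i) \<ge> c * mms n m (u i))"

end

theory Submission
  imports Defs
begin

text \<open>
  Scale each utility so that an optimal split of each agent has three parts of value 1, and suppose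
  no allocation gives everybody 5/6. For each agent, the other two must then both value two of the
  agent's three parts below 5/6; hence both value the third, dominant, part above 4/3. Hand an agent
  one of the non-dominant parts: the other two agents cannot share the remaining path, so neither of
  them has a cut point on it with at least 5/6 on both sides. This forces the cut points of any two
  agents to alternate around the cycle, and each cut point inside a dominant part of another agent
  has more than 1/2 on either side within that part. So the nine cut points occur in the cyclic order
  a, b, c, a, b, c, a, b, c. The dominant part of each agent must then have index one less modulo 3
  than that of the agent preceding it in this order; going once around the
  three agents shifts the index by -3, which is 0 modulo 3, yet returning to agent a one round later
  shifts its index by -1: a contradiction.
\<close>

subsection \<open>Cut points on the lifted cycle\<close>

text \<open>
  Positions on the cycle are lifted to the integers. \<open>F y - F x\<close> is the value of the
  goods at the positions \<open>x, \<dots>, y - 1\<close>, and \<open>a\<close> lists the cut points of a split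
  into parts of value 1.
\<close>

definition cut_value :: "int \<Rightarrow> (int \<Rightarrow> real) \<Rightarrow> (int \<Rightarrow> int) \<Rightarrow> bool" where
  "cut_value m F a \<longleftrightarrow> mono F \<and> (\<forall>x. F (x + m) = F x + 3) \<and>
     (\<forall>k. a (k + 3) = a k + m) \<and> (\<forall>k. F (a k) = of_int k)"

definition fair :: "int \<Rightarrow> (int \<Rightarrow> real) \<Rightarrow> (int \<Rightarrow> real) \<Rightarrow> (int \<Rightarrow> real) \<Rightarrow> bool" where
  "fair m F G H \<longleftrightarrow> (\<exists>x y z. x \<le> y \<and> y \<le> z \<and> z \<le> x + m \<and>
     5/6 \<le> F y - F x \<and> 5/6 \<le> G z - G y \<and> 5/6 \<le> H (x + m) - H z)"

text \<open>Rotations of the three agents are covered by \<open>fair_rotate\<close> below.\<close>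

definition conflict :: "int \<Rightarrow> (int \<Rightarrow> real) \<Rightarrow> (int \<Rightarrow> real) \<Rightarrow> (int \<Rightarrow> real) \<Rightarrow> bool" where
  "conflict m F G H \<longleftrightarrow> \<not> fair m F G H \<and> \<not> fair m F H G"

text \<open>Part \<open>p\<close> runs from \<open>a p\<close> to \<open>a (p + 1)\<close>. When
  \<open>G\<close> totals 3 per turn, the two bounds leave part \<open>p\<close> worth more than 4/3
  to \<open>G\<close>.\<close>

definition dominant_part :: "(int \<Rightarrow> int) \<Rightarrow> (int \<Rightarrow> real) \<Rightarrow> int \<Rightarrow> bool" where
  "dominant_part a G p \<longleftrightarrow>
     G (a (p + 2)) - G (a (p + 1)) < 5/6 \<and> G (a (p + 3)) - G (a (p + 2)) < 5/6"

lemma cut_valueD: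
  assumes "cut_value m F a"
  shows "x \<le> y \<Longrightarrow> F x \<le> F y" "F (x + m) = F x + 3" "a (k + 3) = a k + m"
    "F (a k) = of_int k"
  using assms by (auto simp: cut_value_def mono_def)

lemma cut_value_less:
  assumes "cut_value m F a" "F x < F y"
  shows "x < y"
  using cut_valueD(1)[OF assms(1), of y x] assms(2) by linarith

lemma cut_le: "cut_value m F a \<Longrightarrow> k \<le> l \<Longrightarrow> a k \<le> a l"
  by (cases "k = l") (auto intro!: order_less_imp_le cut_value_less simp: cut_valueD(4))

lemma cut_shift:
  assumes "cut_value m F a"
  shows "a (k + 3 * t) = a k + t * m"
proof (induction t rule: int_induct[where k = 0])
  case (step1 i)
  then show ?case using cut_valueD(3)[OF assms, of "k + 3 * i"] by (simp add: algebra_simps)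
next
  case (step2 i)
  then show ?case using cut_valueD(3)[OF assms, of "k + 3 * (i - 1)"] by (simp add: algebra_simps)
qed simp

lemma value_shift:
  fixes F :: "int \<Rightarrow> real"
  assumes "\<And>x. F (x + m) = F x + 3"
  shows "F (x + t * m) = F x + 3 * of_int t"
proof (induction t rule: int_induct[where k = 0])
  case (step1 i)
  then show ?case using assms[of "x + i * m"] by (simp add: algebra_simps)
next
  case (step2 i)
  then show ?case using assms[of "x + (i - 1) * m"] by (simp add: algebra_simps)
qed simp

text \<open>Since \<open>fair\<close> sees only differences of the utilities, this renumbering lets
  the cut points of different agents be aligned freely.\<close>

lemma cut_value_reindex:
  assumes "cut_value m F a"
  shows "cut_value m (\<lambda>x. F x - of_int s) (\<lambda>k. a (k + s))"
  using assms cut_valueD(3)[OF assms, of "_ + s"]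
  unfolding cut_value_def mono_def by (auto simp: algebra_simps)

lemma dominant_part_shift:
  assumes "cut_value m F a" "cut_value m G b" "dominant_part a G p"
  shows "dominant_part a G (p + 3 * t)"
proof -
  have "a (p + 3 * t + j) = a (p + j) + t * m" for j
    using cut_shift[OF assms(1), of "p + j" t] by (simp add: algebra_simps)
  then show ?thesis
    using assms(3) by (simp add: dominant_part_def value_shift[of G m, OF cut_valueD(2)[OF assms(2)]])
qed

lemma fair_diff:
  "fair m (\<lambda>x. F x - r) G H \<longleftrightarrow> fair m F G H"
  "fair m F (\<lambda>x. G x - r) H \<longleftrightarrow> fair m F G H"
  "fair m F G (\<lambda>x. H x - r) \<longleftrightarrow> fair m F G H"
  by (simp_all add: fair_def)

lemma conflict_diff:
  "conflict m (\<lambda>x. F x - r) G H \<longleftrightarrow> conflict m F G H"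
  "conflict m F (\<lambda>x. G x - r) H \<longleftrightarrow> conflict m F G H"
  "conflict m F G (\<lambda>x. H x - r) \<longleftrightarrow> conflict m F G H"
  by (simp_all add: conflict_def fair_diff)

text \<open>The same three arcs are read starting from \<open>y\<close>; the arc of the first agent
  moves up by one turn.\<close>

lemma fair_rotate:
  assumes "cut_value m F a" "fair m F G H"
  shows "fair m G H F"
proof -
  obtain x y z where "x \<le> y" "y \<le> z" "z \<le> x + m"
    "5/6 \<le> F y - F x" "5/6 \<le> G z - G y" "5/6 \<le> H (x + m) - H z"
    using assms(2) unfolding fair_def by blast
  then show ?thesis
    unfolding fair_def using cut_valueD(2)[OF assms(1)]
    by (intro exI[of _ y] exI[of _ z] exI[of _ "x + m"]) auto
qed

lemma conflict_rotate:
  assumes "cut_value m F a" "cut_value m G b" "cut_value m H c" "conflict m F G H"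
  shows "conflict m G H F"
  using assms fair_rotate unfolding conflict_def by metis

lemma conflict_swap: "conflict m F G H \<Longrightarrow> conflict m F H G"
  by (simp add: conflict_def)

lemma conflictD:
  assumes "conflict m F G H" "x \<le> y" "y \<le> z" "z \<le> x + m"
  shows "\<not> (5/6 \<le> F y - F x \<and> 5/6 \<le> G z - G y \<and> 5/6 \<le> H (x + m) - H z)"
    "\<not> (5/6 \<le> F y - F x \<and> 5/6 \<le> H z - H y \<and> 5/6 \<le> G (x + m) - G z)"
  using assms unfolding conflict_def fair_def by blast+

section \<open>Dominant parts and the alternation of cut points\<close>

text \<open>Call a part of the \<open>a\<close>-split good for an agent who values it at 5/6 or
  more. \<open>G\<close> and \<open>H\<close> each have a good part, as three parts add up to 3.
  Distinct parts good for \<open>G\<close> and for \<open>H\<close> would leave the third to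
  \<open>F\<close>, so both agents have one and the same single good part.\<close>

lemma dominant_part_exists:
  assumes F: "cut_value m F a" and G: "cut_value m G b" and H: "cut_value m H c"
    and conf: "conflict m F G H"
  shows "\<exists>p. dominant_part a G p \<and> dominant_part a H p"
proof -
  define g where "g k = G (a (k + 1)) - G (a k)" for k
  define h where "h k = H (a (k + 1)) - H (a k)" for k
  \<comment> \<open>\<open>F\<close> keeps part \<open>k + 3\<close>, which is part \<open>k\<close>
    one turn later; \<open>G\<close> and \<open>H\<close> share the other two in either
    order.\<close>
  have *: "\<not> (5/6 \<le> g (k + 1) \<and> 5/6 \<le> h (k + 2)) \<and> \<not> (5/6 \<le> h (k + 1) \<and> 5/6 \<le> g (k + 2))" for k
  proof -
    have confG: "conflict m G H F" using conflict_rotate[OF F G H conf] .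
    have "a (k + 1) \<le> a (k + 2)" "a (k + 2) \<le> a (k + 3)" "a (k + 3) \<le> a (k + 1) + m"
      using cut_le[OF F, of "k + 3" "k + 4"] cut_valueD(3)[OF F, of "k + 1"]
      by (auto simp: add.assoc intro!: cut_le[OF F])
    moreover have "5/6 \<le> F (a (k + 1) + m) - F (a (k + 3))"
      unfolding cut_valueD(3)[OF F, symmetric] by (simp add: cut_valueD(4)[OF F])
    ultimately show ?thesis
      using conflictD(1)[OF confG, of "a (k + 1)" "a (k + 2)" "a (k + 3)"]
        conflictD(2)[OF conflict_rotate[OF G H F confG], of "a (k + 1)" "a (k + 2)" "a (k + 3)"]
      by (simp add: g_def h_def add.assoc)
  qed
  have per: "g (k + 3) = g k" "h (k + 3) = h k" for k
    using cut_valueD(3)[OF F, of k] cut_valueD(3)[OF F, of "k + 1"]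
    by (simp_all add: g_def h_def cut_valueD(2)[OF G] cut_valueD(2)[OF H] add.assoc)
  have tot: "g 0 + g 1 + g 2 = 3" "h 0 + h 1 + h 2 = 3"
    using cut_valueD(3)[OF F, of 0] cut_valueD(2)[OF G, of "a 0"] cut_valueD(2)[OF H, of "a 0"]
    by (simp_all add: g_def h_def)
  have dom: "dominant_part a G p \<and> dominant_part a H p"
    if "g (p + 1) < 5/6" "g (p + 2) < 5/6" "h (p + 1) < 5/6" "h (p + 2) < 5/6" for p
    using that by (simp add: dominant_part_def g_def h_def add.assoc)
  have "g 3 = g 0" "h 3 = h 0" "g 4 = g 1" "h 4 = h 1"
    using per[of 0] per[of 1] by simp_all
  moreover have "\<not> (5/6 \<le> g 0 \<and> 5/6 \<le> h 1) \<and> \<not> (5/6 \<le> h 0 \<and> 5/6 \<le> g 1)"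
    "\<not> (5/6 \<le> g 1 \<and> 5/6 \<le> h 2) \<and> \<not> (5/6 \<le> h 1 \<and> 5/6 \<le> g 2)"
    "\<not> (5/6 \<le> g 2 \<and> 5/6 \<le> h 3) \<and> \<not> (5/6 \<le> h 2 \<and> 5/6 \<le> g 3)"
    using *[of "-1"] *[of 0] *[of 1] by simp_all
  ultimately have "(g 1 < 5/6 \<and> g 2 < 5/6 \<and> h 1 < 5/6 \<and> h 2 < 5/6) \<or>
      (g 2 < 5/6 \<and> g 3 < 5/6 \<and> h 2 < 5/6 \<and> h 3 < 5/6) \<or>
      (g 3 < 5/6 \<and> g 4 < 5/6 \<and> h 3 < 5/6 \<and> h 4 < 5/6)"
    using tot by argo
  then show ?thesis using dom[of 0] dom[of 1] dom[of 2] by auto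
qed

text \<open>\<open>F\<close> takes the arc from \<open>y\<close> to \<open>x + m\<close>.
  \<open>H\<close> values one side of \<open>w\<close> above 13/12 and takes it, leaving the other
  side to \<open>G\<close>. The bound 13/6 is 3 - 5/6, the value to \<open>H\<close> of a path
  missing one non-dominant part.\<close>

lemma no_common_halving:
  assumes G: "cut_value m G b"
    and conf: "conflict m F G H" and "x \<le> w" "w \<le> y" "y \<le> x + m"
    and F: "5/6 \<le> F (x + m) - F y" and HH: "13/6 < H y - H x"
    and Fc: "cut_value m F a" and Hc: "cut_value m H c"
  shows "\<not> (5/6 \<le> G w - G x \<and> 5/6 \<le> G y - G w)"
proof -
  have "conflict m G H F"
    using conflict_rotate[OF Fc G Hc conf] .
  moreover have "conflict m H F G"
    using conflict_rotate[OF G Hc Fc] calculation .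
  ultimately show ?thesis
    using conflictD[of m G H F x w y] conflictD[of m H F G x w y] assms(3-7) by argo
qed

text \<open>\<open>F\<close> is given part \<open>p + 1\<close> or part \<open>p + 2\<close>. In
  both cases \<open>no_common_halving\<close> excludes every cut point of \<open>G\<close> as a
  halving point of the remaining path, which confines the values of \<open>G\<close> at the
  \<open>a\<close>-points between integers. The offset \<open>s\<close> accounts for the arbitrary
  numbering of \<open>b\<close>.\<close>

lemma interleaving:
  assumes F: "cut_value m F a" and G: "cut_value m G b" and H: "cut_value m H c"
    and conf: "conflict m F G H"
    and domG: "dominant_part a G p" and domH: "dominant_part a H p"
  shows "\<exists>s. (\<forall>k. a k < b (k + s) \<and> b (k + s) < a (k + 1)) \<and>
     G (a p) < of_int (p + s) - 1/2 \<and> of_int (p + s) + 1/2 < G (a (p + 1))"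
proof -
  define A0 A1 A2 A3 where "A0 = G (a (p - 1))" and "A1 = G (a p)"
    and "A2 = G (a (p + 1))" and "A3 = G (a (p + 2))"
  \<comment> \<open>The least integers above \<open>A0\<close> and \<open>A1\<close>: indices of the
    candidates for the first cut points of \<open>G\<close> past \<open>a (p - 1)\<close> and
    \<open>a p\<close>.\<close>
  define k l where "k = \<lfloor>A0\<rfloor> + 1" and "l = \<lfloor>A1\<rfloor> + 1"
  have k: "of_int k - 1 \<le> A0" "A0 < of_int k" and l: "of_int l - 1 \<le> A1" "A1 < of_int l"
    unfolding k_def l_def by linarith+
  have a3: "a (p + 2) = a (p - 1) + m" "a (p + 3) = a p + m"
    using cut_valueD(3)[OF F, of "p - 1"] cut_valueD(3)[OF F, of p] by (simp_all add: add.commute)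
  have A3: "A3 = A0 + 3"
    unfolding A3_def A0_def a3 cut_valueD(2)[OF G] ..
  have short: "A3 - A2 < 5/6" "A1 - A0 < 5/6"
    using domG by (simp_all add: dominant_part_def A0_def A1_def A2_def A3_def a3 cut_valueD(2)[OF G])
  have below: "x < b j" if "G x < of_int j" for x j
    using cut_value_less[OF G, of x "b j"] that by (simp add: cut_valueD(4)[OF G])
  have above: "b j < x" if "of_int j < G x" for x j
    using cut_value_less[OF G, of "b j" x] that by (simp add: cut_valueD(4)[OF G])
  have HL: "13/6 < H (a (p + 1)) - H (a (p - 1))" and HR: "13/6 < H (a (p + 2)) - H (a p)"
    using domH by (simp_all add: dominant_part_def a3 cut_valueD(2)[OF H])
  \<comment> \<open>\<open>F\<close> holds part \<open>p + 1\<close>; the path from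
    \<open>a (p - 1)\<close> to \<open>a (p + 1)\<close> remains.\<close>
  have left: "\<not> (5/6 \<le> of_int j - A0 \<and> 5/6 \<le> A2 - of_int j)" for j
  proof
    assume *: "5/6 \<le> of_int j - A0 \<and> 5/6 \<le> A2 - of_int j"
    then have "a (p - 1) \<le> b j" "b j \<le> a (p + 1)"
      using below[of "a (p - 1)" j] above[of j "a (p + 1)"] by (auto simp: A0_def A2_def)
    moreover have "a (p + 1) \<le> a (p - 1) + m"
      using cut_le[OF F, of "p + 1" "p + 2"] a3 by simp
    moreover have "5/6 \<le> F (a (p - 1) + m) - F (a (p + 1))"
      unfolding a3(1)[symmetric] cut_valueD(4)[OF F] by simp
    ultimately show False
      using no_common_halving[OF G conf _ _ _ _ HL F H, of "b j"] *
      by (simp add: A0_def A2_def cut_valueD(4)[OF G])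
  qed
  \<comment> \<open>\<open>F\<close> holds part \<open>p + 2\<close>; the path from
    \<open>a p\<close> to \<open>a (p + 2)\<close> remains.\<close>
  have right: "\<not> (5/6 \<le> of_int j - A1 \<and> 5/6 \<le> A3 - of_int j)" for j
  proof
    assume *: "5/6 \<le> of_int j - A1 \<and> 5/6 \<le> A3 - of_int j"
    then have "a p \<le> b j" "b j \<le> a (p + 2)"
      using below[of "a p" j] above[of j "a (p + 2)"] by (auto simp: A1_def A3_def)
    moreover have "a (p + 2) \<le> a p + m"
      using cut_le[OF F, of "p + 2" "p + 3"] a3 by simp
    moreover have "5/6 \<le> F (a p + m) - F (a (p + 2))"
      unfolding a3(2)[symmetric] cut_valueD(4)[OF F] by simp
    ultimately show False
      using no_common_halving[OF G conf _ _ _ _ HR F H, of "b j"] *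
      by (simp add: A1_def A3_def cut_valueD(4)[OF G])
  qed
  \<comment> \<open>If \<open>k - A0\<close> were at least 5/6, then \<open>A2 - k > 7/6\<close>
    would contradict \<open>left\<close>. As \<open>k + 1 - A0 > 1\<close>, \<open>left\<close> at
    \<open>k + 1\<close> bounds the other side. The bounds \<open>lb\<close> follow likewise from
    \<open>right\<close>.\<close>
  have kb: "of_int k - A0 < 5/6" "A2 - (of_int k + 1) < 5/6"
    using left[of k] left[of "k + 1"] k short A3 by auto
  have lb: "of_int l - A1 < 5/6" "A3 - (of_int l + 1) < 5/6"
    using right[of l] right[of "l + 1"] l short A3 by auto
  have "of_int k < (of_int l :: real)" "of_int l < (of_int k + 2 :: real)"
    using kb lb short A3 by linarith+
  then have lk: "l = k + 1" by linarith
  \<comment> \<open>Chosen so that \<open>p + s = l\<close>, the index of the cut point of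
    \<open>G\<close> inside the dominant part.\<close>
  define s where "s = k + 1 - p"
  have "a (p - 1) < b k" "a p < b (k + 1)" "a (p + 1) < b (k + 2)"
    using k l lk kb A3 by (intro below; simp add: A0_def A1_def A2_def)+
  moreover have "b k < a p" "b (k + 1) < a (p + 1)" "b (k + 2) < a (p + 2)"
    using k l lk lb kb short A3 by (intro above; simp add: A0_def A1_def A2_def A3_def)+
  ultimately have base: "a (p + j) < b (p + j + s) \<and> b (p + j + s) < a (p + j + 1)"
    if "j \<in> {-1, 0, 1}" for j
    using that by (auto simp: s_def add.commute)
  have "a j < b (j + s) \<and> b (j + s) < a (j + 1)" for j
  proof -
    define t where "t = (j - p + 1) div 3"
    \<comment> \<open>Remainders are centred to -1, 0, 1, the window around \<open>p\<close> settled
      in \<open>base\<close>; periodicity does the rest.\<close>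
    define i where "i = (j - p + 1) mod 3 - 1"
    have j: "j = p + i + 3 * t" and i: "i \<in> {-1, 0, 1}"
      unfolding i_def t_def by presburger (simp, presburger)
    show ?thesis
      using base[OF i] cut_shift[OF F, of "p + i" t] cut_shift[OF F, of "p + i + 1" t]
        cut_shift[OF G, of "p + i + s" t]
      unfolding j by (simp add: algebra_simps)
  qed
  moreover have "A1 < of_int (p + s) - 1/2" "of_int (p + s) + 1/2 < A2"
    using kb lb lk short A3 by (simp_all add: s_def)
  ultimately show ?thesis
    unfolding A1_def A2_def by blast
qed

section \<open>Offsets of dominant parts and the contradiction\<close>

text \<open>With the cut points already numbered in step, the offset from
  \<open>interleaving\<close> can only be 0: otherwise \<open>b s\<close> falls outside the gap
  between \<open>a 0\<close> and \<open>a 1\<close>.\<close>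

lemma dominant_part_halves:
  assumes F: "cut_value m F a" and G: "cut_value m G b" and H: "cut_value m H c"
    and conf: "conflict m F G H"
    and dom: "dominant_part a G p" "dominant_part a H p"
    and ord: "\<And>k. a k < b k \<and> b k < a (k + 1)"
  shows "G (a p) < of_int p - 1/2" "of_int p + 1/2 < G (a (p + 1))"
proof -
  obtain s where s: "\<And>k. a k < b (k + s) \<and> b (k + s) < a (k + 1)"
    and gs: "G (a p) < of_int (p + s) - 1/2" "of_int (p + s) + 1/2 < G (a (p + 1))"
    using interleaving[OF F G H conf dom] by blast
  have "s < 1"
    using cut_le[OF G, of 1 s] s[of 0] ord[of 1] by force
  moreover have "s > -1"
    using cut_le[OF G, of s "-1"] s[of 0] ord[of "-1"] by force
  ultimately have "s = 0" by simp
  then show "G (a p) < of_int p - 1/2" "of_int p + 1/2 < G (a (p + 1))"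
    using gs by simp_all
qed

text \<open>\<open>H\<close> has more than 1/2 after \<open>c p\<close> within the dominant part of
  \<open>a\<close>, and more than 1/2 before \<open>c q\<close> within that of \<open>b\<close>. If
  \<open>q = p\<close>, these pieces join to an arc worth more than 1 to \<open>H\<close>, and the
  rest serves \<open>F\<close> and \<open>G\<close>. If \<open>q = p + 1\<close>, the bounds
  contradict \<open>a (p + 1) < b (p + 1)\<close>.\<close>

lemma dominant_parts_offset:
  assumes F: "cut_value m F a" and G: "cut_value m G b" and H: "cut_value m H c"
    and conf: "conflict m F G H"
    and ord: "\<And>k. a k < b k \<and> b k < c k \<and> c k < a (k + 1)"
    and p: "dominant_part a G p" "dominant_part a H p"
    and q: "dominant_part b H q" "dominant_part b F q"
  shows "(q - p) mod 3 = 2"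
proof (rule ccontr)
  assume offset: "(q - p) mod 3 \<noteq> 2"
  \<comment> \<open>Shifts \<open>q\<close> by a multiple of 3 to
    \<open>p + (q - p) mod 3\<close>.\<close>
  define t where "t = - ((q - p) div 3)"
  have t: "q + 3 * t = p \<or> q + 3 * t = p + 1"
    using offset unfolding t_def by presburger
  have ac: "a k < c k \<and> c k < a (k + 1)" and bc: "b k < c k \<and> c k < b (k + 1)" for k
    using ord[of k] ord[of "k + 1"] by auto
  have confG: "conflict m G H F" using conflict_rotate[OF F G H conf] .
  have Ha: "of_int p + 1/2 < H (a (p + 1))"
    using dominant_part_halves(2)[OF F H G conflict_swap[OF conf] p(2,1) ac] .
  have Hb: "H (b (q + 3 * t)) < of_int (q + 3 * t) - 1/2"
    using dominant_part_halves(1)[OF G H F confG _ _ bc] dominant_part_shift[OF G H q(1)]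
      dominant_part_shift[OF G F q(2)] by blast
  from t show False
  proof
    assume "q + 3 * t = p"
    then have "5/6 \<le> H (a (p + 1)) - H (b p)" using Ha Hb by simp
    \<comment> \<open>The arc for \<open>G\<close> contains its own part from
      \<open>b (p - 1)\<close> to \<open>b p\<close>; below, \<open>F\<close> receives its part
      \<open>p + 1\<close>.\<close>
    moreover have "5/6 \<le> G (b p) - G (a (p - 1))"
      using cut_valueD(1)[OF G, of "a (p - 1)" "b (p - 1)"] ord[of "p - 1"]
      by (simp add: cut_valueD(4)[OF G])
    moreover have "5/6 \<le> F (a (p - 1) + m) - F (a (p + 1))"
      using cut_valueD(3)[OF F, of "p - 1", symmetric] by (simp add: cut_valueD(4)[OF F])
    moreover have "a (p - 1) \<le> b p" "b p \<le> a (p + 1)" "a (p + 1) \<le> a (p - 1) + m"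
      using ord[of "p - 1"] ord[of p] cut_le[OF F, of "p - 1" p] cut_le[OF F, of "p + 1" "p + 2"]
        cut_valueD(3)[OF F, of "p - 1"] by (auto simp: add.commute)
    ultimately show False
      using conflictD(1)[OF confG, of "a (p - 1)" "b p" "a (p + 1)"] by blast
  next
    assume "q + 3 * t = p + 1"
    then show False
      using Ha Hb cut_valueD(1)[OF H, of "a (p + 1)" "b (p + 1)"] ord[of "p + 1"] by simp
  qed
qed

text \<open>The offset is computed for \<open>a, b, c\<close>, then \<open>b, c, a'\<close>, then
  \<open>c, a', b'\<close>, where \<open>a'\<close> and \<open>b'\<close> are numbered one later to
  keep the order. Renumbering turns \<open>p\<close> into \<open>p - 1\<close>, so the three
  differences add up to -1, while their residues 2 add up to 0 modulo 3.\<close>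

lemma no_conflict_if_ordered:
  assumes F: "cut_value m F a" and G: "cut_value m G b" and H: "cut_value m H c"
    and conf: "conflict m F G H"
    and ord: "\<And>k. a k < b k \<and> b k < c k \<and> c k < a (k + 1)"
  shows False
proof -
  have confG: "conflict m G H F" using conflict_rotate[OF F G H conf] .
  have confH: "conflict m H F G" using conflict_rotate[OF G H F confG] .
  obtain p where p: "dominant_part a G p" "dominant_part a H p"
    using dominant_part_exists[OF F G H conf] by blast
  obtain q where q: "dominant_part b H q" "dominant_part b F q"
    using dominant_part_exists[OF G H F confG] by blast
  obtain r where r: "dominant_part c F r" "dominant_part c G r"
    using dominant_part_exists[OF H F G confH] by blast
  define F' a' G' b' where "F' = (\<lambda>x. F x - of_int 1)" and "a' = (\<lambda>k. a (k + 1))"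
    and "G' = (\<lambda>x. G x - of_int 1)" and "b' = (\<lambda>k. b (k + 1))"
  have F': "cut_value m F' a'" and G': "cut_value m G' b'"
    unfolding F'_def a'_def G'_def b'_def by (rule cut_value_reindex F G)+
  have "(q - p) mod 3 = 2"
    using dominant_parts_offset[OF F G H conf ord p q] .
  moreover have "(r - q) mod 3 = 2"
  proof (rule dominant_parts_offset[OF G H F'])
    show "conflict m G H F'" using confG by (simp only: F'_def conflict_diff)
    show "b k < c k \<and> c k < a' k \<and> a' k < b (k + 1)" for k
      using ord[of k] ord[of "k + 1"] by (simp add: a'_def)
    show "dominant_part b H q" "dominant_part c G r" by fact+
    show "dominant_part b F' q" "dominant_part c F' r"
      using q r by (simp_all add: dominant_part_def F'_def)
  qed
  moreover have "((p - 1) - r) mod 3 = 2"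
  proof (rule dominant_parts_offset[OF H F' G'])
    show "conflict m H F' G'" using confH by (simp only: F'_def G'_def conflict_diff)
    show "c k < a' k \<and> a' k < b' k \<and> b' k < c (k + 1)" for k
      using ord[of k] ord[of "k + 1"] by (simp add: a'_def b'_def)
    show "dominant_part c F' r" "dominant_part c G' r"
      "dominant_part a' G' (p - 1)" "dominant_part a' H (p - 1)"
      using p r by (simp_all add: dominant_part_def F'_def G'_def a'_def algebra_simps)
  qed
  ultimately show False by presburger
qed

text \<open>After \<open>b\<close> and \<open>c\<close> are aligned with \<open>a\<close>, the
  offset \<open>d\<close> between them is 0 or 1. These are the two cyclic orders of the agents; the
  second is reduced to the first by swapping \<open>G\<close> and \<open>H\<close>.\<close>

lemma no_conflict:
  assumes F: "cut_value m F a" and G: "cut_value m G b" and H: "cut_value m H c"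
  shows "\<not> conflict m F G H"
proof
  assume conf: "conflict m F G H"
  obtain p where p: "dominant_part a G p" "dominant_part a H p"
    using dominant_part_exists[OF F G H conf] by blast
  obtain s where s: "\<And>k. a k < b (k + s) \<and> b (k + s) < a (k + 1)"
    using interleaving[OF F G H conf p] by blast
  obtain t where t: "\<And>k. a k < c (k + t) \<and> c (k + t) < a (k + 1)"
    using interleaving[OF F H G conflict_swap[OF conf] p(2,1)] by blast
  define G' b' H' c' where "G' = (\<lambda>x. G x - of_int s)" and "b' = (\<lambda>k. b (k + s))"
    and "H' = (\<lambda>x. H x - of_int t)" and "c' = (\<lambda>k. c (k + t))"
  have G': "cut_value m G' b'" and H': "cut_value m H' c'"
    unfolding G'_def b'_def H'_def c'_def by (rule cut_value_reindex G H)+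
  have conf': "conflict m F G' H'"
    using conf by (simp only: G'_def H'_def conflict_diff)
  have confG: "conflict m G' H' F" using conflict_rotate[OF F G' H' conf'] .
  have ab: "a k < b' k \<and> b' k < a (k + 1)" and ac: "a k < c' k \<and> c' k < a (k + 1)" for k
    using s t by (simp_all add: b'_def c'_def)
  obtain q where q: "dominant_part b' H' q" "dominant_part b' F q"
    using dominant_part_exists[OF G' H' F confG] by blast
  obtain d where d: "\<And>k. b' k < c' (k + d) \<and> c' (k + d) < b' (k + 1)"
    using interleaving[OF G' H' F confG q] by blast
  \<comment> \<open>For \<open>d\<close> at least 2, \<open>c' 2 < b' 1 < a 2\<close>; for negative
    \<open>d\<close>, \<open>c' (-1) > b' 0 > a 0\<close>. Both violate \<open>ac\<close>.\<close>
  have "d < 2"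
    using cut_le[OF H', of 2 d] d[of 0] ab[of 1] ac[of 2] by force
  moreover have "d > -1"
    using cut_le[OF H', of d "-1"] d[of 0] ab[of 0] ac[of "-1"] by force
  ultimately consider "d = 0" | "d = 1" by linarith
  then show False
  proof cases
    case 1
    then show False
      using no_conflict_if_ordered[OF F G' H' conf'] d ab ac by fastforce
  next
    case 2
    then have "c' k < b' k" for k using d[of "k - 1"] by auto
    then show False
      using no_conflict_if_ordered[OF F H' G' conflict_swap[OF conf']] ab ac by fastforce
  qed
qed

subsection \<open>Arcs and bundles\<close>

definition good_at :: "nat \<Rightarrow> int \<Rightarrow> nat" where
  "good_at m t = nat (t mod int m)"

definition arc :: "nat \<Rightarrow> int \<Rightarrow> int \<Rightarrow> nat set" where
  "arc m x y = good_at m ` {x..<y}"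

lemma good_at_less: "m > 0 \<Longrightarrow> good_at m t < m"
  by (simp add: good_at_def nat_less_iff)

lemma int_good_at: "m > 0 \<Longrightarrow> int (good_at m t) = t mod int m"
  by (simp add: good_at_def)

lemma good_at_shift: "good_at m (t + int m) = good_at m t"
  by (simp add: good_at_def)

lemma good_at_eq_iff: "m > 0 \<Longrightarrow> good_at m s = good_at m t \<longleftrightarrow> s mod int m = t mod int m"
  by (simp add: good_at_def eq_nat_nat_iff)

lemma inj_on_good_at:
  assumes "m > 0" "y \<le> x + int m"
  shows "inj_on (good_at m) {x..<y}"
proof (rule inj_onI)
  fix s t assume st: "s \<in> {x..<y}" "t \<in> {x..<y}" "good_at m s = good_at m t"
  then have "int m dvd s - t"
    using assms(1) by (simp add: good_at_eq_iff mod_eq_dvd_iff)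
  moreover have "\<bar>s - t\<bar> < int m" using st assms(2) by auto
  ultimately show "s = t"
    using zdvd_imp_le[of "int m" "\<bar>s - t\<bar>"] by auto
qed

lemma good_at_representative:
  assumes "m > 0" "g < m"
  obtains t where "x \<le> t" "t < x + int m" "good_at m t = g"
proof
  let ?t = "x + (int g - x) mod int m"
  show "x \<le> ?t" "?t < x + int m" using assms by simp_all
  show "good_at m ?t = g" using assms by (simp add: good_at_def mod_add_right_eq)
qed

lemma good_at_succ: "m > 0 \<Longrightarrow> good_at m (t + 1) = Suc (good_at m t) mod m"
  by (rule of_nat_eq_iff[where 'a = int, THEN iffD1])
    (simp add: int_good_at zmod_int mod_add_right_eq add.commute)

text \<open>Successive positions carry adjacent goods, which gives walks upwards; symmetry of
  adjacency reverses them.\<close>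

lemma is_bundle_arc:
  assumes "m > 0"
  shows "is_bundle m (arc m x y)"
proof -
  define R where "R = (\<lambda>a b. a \<in> arc m x y \<and> b \<in> arc m x y \<and> cycle_adj m a b)"
  have sym: "R b a" if "R a b" for a b
    using that by (auto simp: R_def cycle_adj_def)
  have path: "R\<^sup>*\<^sup>* (good_at m s) (good_at m t)" if "x \<le> s" "s \<le> t" "t < y" for s t
    using that(2,3)
  proof (induction t rule: int_ge_induct)
    case (step t)
    then have "good_at m t \<in> arc m x y" "good_at m (t + 1) \<in> arc m x y"
      using that(1) by (simp_all add: arc_def)
    then have "R (good_at m t) (good_at m (t + 1))"
      using assms good_at_less[OF assms] good_at_succ[OF assms] by (simp add: R_def cycle_adj_def)
    then show ?case using step by simp
  qed simp
  have "R\<^sup>*\<^sup>* g h" if gh: "g \<in> arc m x y" "h \<in> arc m x y" for g h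
  proof -
    obtain s t where st: "s \<in> {x..<y}" "t \<in> {x..<y}" "g = good_at m s" "h = good_at m t"
      using gh unfolding arc_def by blast
    have "R\<^sup>*\<^sup>* h g" if "R\<^sup>*\<^sup>* g h" for g h
      using that by induction (auto intro: converse_rtranclp_into_rtranclp sym)
    then show ?thesis using st path[of s t] path[of t s] by (cases "s \<le> t") auto
  qed
  then show ?thesis
    unfolding is_bundle_def R_def using good_at_less[OF assms] by (auto simp: arc_def)
qed

lemma arcs_partition:
  assumes "m > 0" "x \<le> y" "y \<le> z" "z \<le> x + int m"
  shows "arc m x y \<inter> arc m y z = {}" "arc m x y \<inter> arc m z (x + int m) = {}"
    "arc m y z \<inter> arc m z (x + int m) = {}"
    "arc m x y \<union> arc m y z \<union> arc m z (x + int m) = {..<m}"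
proof -
  have inj: "inj_on (good_at m) {x..<x + int m}" using inj_on_good_at[OF assms(1)] by simp
  show "arc m x y \<inter> arc m y z = {}" "arc m x y \<inter> arc m z (x + int m) = {}"
    "arc m y z \<inter> arc m z (x + int m) = {}"
    unfolding arc_def using assms by (auto dest!: inj_onD[OF inj])
  have "arc m x y \<union> arc m y z \<union> arc m z (x + int m) = good_at m ` {x..<x + int m}"
    unfolding arc_def image_Un[symmetric] using assms by (intro arg_cong[of _ _ "image _"]) auto
  also have "\<dots> = {..<m}"
  proof (intro equalityI subsetI)
    fix g assume "g \<in> {..<m}"
    then obtain t where "x \<le> t" "t < x + int m" "good_at m t = g"
      using good_at_representative[OF assms(1), of g x] by auto
    then show "g \<in> good_at m ` {x..<x + int m}" by auto
  qed (auto simp: good_at_less[OF assms(1)])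
  finally show "arc m x y \<union> arc m y z \<union> arc m z (x + int m) = {..<m}" .
qed

lemma all_less_3: "(\<forall>i<3. Q i) \<longleftrightarrow> Q 0 \<and> Q 1 \<and> Q (2::nat)"
  by (auto simp: numeral_3_eq_3 less_Suc_eq numeral_2_eq_2)

lemma n_split_3I:
  assumes "is_bundle m A" "is_bundle m B" "is_bundle m C"
    and "A \<inter> B = {}" "A \<inter> C = {}" "B \<inter> C = {}" "A \<union> B \<union> C = {..<m}"
  shows "n_split 3 m ((!) [A, B, C])"
proof -
  have "(\<Union>i<3. ([A, B, C] ! i)) = A \<union> B \<union> C"
    by (simp add: numeral_3_eq_3 lessThan_Suc Un_ac)
  then show ?thesis
    using assms by (simp add: n_split_def all_less_3 Int_commute)
qed

section \<open>Three non-empty bundles as consecutive arcs\<close>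

text \<open>Removing the good at \<open>y\<close> opens the cycle into a path. If the good at
  \<open>t\<close> were missing from \<open>S\<close>, a walk in \<open>S\<close> from
  \<open>s\<close> could cross neither \<open>y\<close> nor \<open>t\<close> and would never reach
  \<open>r\<close>.\<close>

lemma bundle_positions_convex:
  assumes conn: "is_bundle m S" and m: "m > 0" and y: "good_at m y \<notin> S"
    and ord: "y < s" "s \<le> t" "t \<le> r" "r < y + int m"
    and S: "good_at m s \<in> S" "good_at m r \<in> S"
  shows "good_at m t \<in> S"
proof (rule ccontr)
  assume t: "good_at m t \<notin> S"
  define R where "R = (\<lambda>a b. a \<in> S \<and> b \<in> S \<and> cycle_adj m a b)"
  have "R\<^sup>*\<^sup>* (good_at m s) (good_at m r)"
    using conn S unfolding is_bundle_def R_def by blast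
  \<comment> \<open>Invariant of the walk: its current good has a position strictly between
    \<open>y\<close> and \<open>t\<close>.\<close>
  then have "\<exists>j. y < j \<and> j < t \<and> good_at m j = good_at m r"
  proof induction
    case base
    have "s \<noteq> t" using S t by auto
    then show ?case using ord by auto
  next
    case (step a b)
    then obtain j where j: "y < j" "j < t" "good_at m j = a" by blast
    have b: "b \<in> S" "b < m" "b = Suc a mod m \<or> a = Suc b mod m"
      using step by (auto simp: R_def cycle_adj_def)
    obtain i where i: "j - 1 \<le> i" "i < j - 1 + int m" "good_at m i = b"
      using good_at_representative[OF m b(2), of "j - 1"] .
    have "good_at m (j + 1) = b \<or> good_at m (j - 1) = b"
    proof (cases "b = Suc a mod m")
      case True
      then show ?thesis using good_at_succ[OF m, of j] j by simp
    next
      case False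
      then have "good_at m (i + 1) = good_at m (j - 1 + 1)"
        using b i j good_at_succ[OF m] by simp
      then have "int m dvd i - (j - 1)"
        using m by (simp add: good_at_eq_iff mod_eq_dvd_iff algebra_simps)
      then have "good_at m i = good_at m (j - 1)"
        using m by (simp add: good_at_eq_iff mod_eq_dvd_iff algebra_simps)
      then show ?thesis using i by simp
    qed
    moreover have "j + 1 \<noteq> t" if "good_at m (j + 1) = b" using that b t by auto
    moreover have "j - 1 \<noteq> y" if "good_at m (j - 1) = b" using that b y by auto
    ultimately have "\<exists>i. y < i \<and> i < t \<and> good_at m i = b"
      using j by (cases "good_at m (j + 1) = b") (force intro: exI[of _ "j + 1"] exI[of _ "j - 1"])+
    then show ?case .
  qed
  then obtain j where j: "y < j" "j < t" "good_at m j = good_at m r" by blast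
  have "inj_on (good_at m) {y..<y + int m}" using inj_on_good_at[OF m] by simp
  then have "j = r" using j ord by (auto dest!: inj_onD)
  then show False using j ord by simp
qed

text \<open>By convexity the positions of \<open>S\<close> in the window fill the range from the
  least to the greatest; \<open>e\<close> is one past the greatest and may equal
  \<open>y + m\<close>.\<close>

lemma bundle_positions_interval:
  assumes "is_bundle m S" "m > 0" "good_at m y \<notin> S" "S \<noteq> {}"
  obtains s e where "y < s" "s < e" "e \<le> y + int m"
    "\<And>t. y \<le> t \<Longrightarrow> t < y + int m \<Longrightarrow> good_at m t \<in> S \<longleftrightarrow> s \<le> t \<and> t < e"
proof -
  define T where "T = {t \<in> {y<..<y + int m}. good_at m t \<in> S}"
  obtain g where "g \<in> S" using assms(4) by blast
  moreover have "g < m" using assms(1) calculation unfolding is_bundle_def by auto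
  ultimately obtain t where "y \<le> t" "t < y + int m" "good_at m t = g"
    using good_at_representative[OF assms(2), of g y] by blast
  then have "t \<in> T"
    using \<open>g \<in> S\<close> assms(3) by (auto simp: T_def order_less_le)
  then have T: "T \<noteq> {}" "finite T"
    by (auto simp: T_def intro: finite_subset[of _ "{y<..<y + int m}"])
  have min_max: "Min T \<in> T" "Max T \<in> T" "Min T \<le> Max T"
    using T by simp_all
  show thesis
  proof (rule that[of "Min T" "Max T + 1"])
    show "Min T < Max T + 1" using min_max(3) by simp
    show "y < Min T" using min_max(1) unfolding T_def by auto
    show "Max T + 1 \<le> y + int m" using min_max(2) unfolding T_def by auto
    fix t assume t: "y \<le> t" "t < y + int m"
    show "good_at m t \<in> S \<longleftrightarrow> Min T \<le> t \<and> t < Max T + 1"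
    proof
      assume "good_at m t \<in> S"
      then have "t \<in> T" using t assms(3) by (auto simp: T_def order_less_le)
      then show "Min T \<le> t \<and> t < Max T + 1" using T by (simp add: zle_add1_eq_le)
    next
      assume "Min T \<le> t \<and> t < Max T + 1"
      then show "good_at m t \<in> S"
        using bundle_positions_convex[OF assms(1-3), of "Min T" t "Max T"] min_max
        by (auto simp: T_def)
    qed
  qed
qed


lemma n_split_3_subset:
  assumes "n_split 3 m P" "i < 3"
  shows "P i \<subseteq> {..<m}"
proof -
  have "is_bundle m (P i)" using assms unfolding n_split_def by blast
  then show ?thesis unfolding is_bundle_def by (rule conjunct1)
qed

lemma n_split_3_disjoint:
  assumes P: "n_split 3 m P" and ij: "i < 3" "j < 3" and g: "g \<in> P i" "g \<in> P j"
  shows "i = j"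
proof (rule ccontr)
  assume "i \<noteq> j"
  then have "P i \<inter> P j = {}" using P ij unfolding n_split_def by simp
  then show False using g by blast
qed

lemma n_split_3_cases:
  assumes "n_split 3 m P" "g < m"
  shows "g \<in> P 0 \<or> g \<in> P 1 \<or> g \<in> P 2"
proof -
  have "g \<in> (\<Union>i<3. P i)" using assms unfolding n_split_def by simp
  then have "\<not> (\<forall>i<3. g \<notin> P i)" by blast
  then show ?thesis unfolding all_less_3 by blast
qed

text \<open>Indices of bundles do not reveal their order around the cycle, hence a conclusion about
  the set of arcs. Seen from a good of \<open>P 1\<close>, \<open>P 0\<close> is an arc; the bundle
  owning the next good must start right there, and the last bundle is the complement.\<close>

lemma n_split_3_arcs:
  assumes split: "n_split 3 m P" and ne: "\<And>i. i < 3 \<Longrightarrow> P i \<noteq> {}"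
  obtains a b c where "a < b" "b < c" "c \<le> a + int m"
    "{arc m a b, arc m b c, arc m c (a + int m)} \<subseteq> P ` {..<3}"
proof -
  have bundle': "is_bundle m (P i)" if "i < 3" for i
    using split that unfolding n_split_def by blast
  note sub = n_split_3_subset[OF split]
  note disj = n_split_3_disjoint[OF split]
  obtain g where g: "g \<in> P 1" "g < m"
    using ne[of 1] sub[of 1] by auto
  then have m: "m > 0" by simp
  have gy: "good_at m (int g) = g" using g by (simp add: good_at_def)
  then have g0: "good_at m (int g) \<notin> P 0" using g disj[of 0 1 g] by auto
  obtain a b where ab: "int g < a" "a < b" "b \<le> int g + int m"
    and P0: "\<And>t. int g \<le> t \<Longrightarrow> t < int g + int m \<Longrightarrow> good_at m t \<in> P 0 \<longleftrightarrow> a \<le> t \<and> t < b"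
    using bundle_positions_interval[OF bundle' m g0 ne] by auto
  have P0_arc: "P 0 = arc m a b"
  proof (intro equalityI subsetI)
    fix h assume h: "h \<in> P 0"
    then obtain t where "int g \<le> t" "t < int g + int m" "good_at m t = h"
      using good_at_representative[OF m, of h "int g"] sub[of 0] by auto
    then show "h \<in> arc m a b" using P0[of t] h by (auto simp: arc_def)
  next
    fix h assume "h \<in> arc m a b"
    then show "h \<in> P 0" using P0 ab by (auto simp: arc_def)
  qed
  have "good_at m b \<notin> P 0"
  proof (cases "b = int g + int m")
    case True
    then show ?thesis using g0 by (simp add: good_at_shift)
  next
    case False
    then show ?thesis using P0[of b] ab by auto
  qed
  then have "good_at m b \<in> P 1 \<or> good_at m b \<in> P 2"
    using n_split_3_cases[OF split good_at_less[OF m, of b]] by blast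
  then obtain j k where jk: "{j, k} = {1, 2::nat}" "j \<noteq> k" and bj: "good_at m b \<in> P j"
    using that[of 1 2] that[of 2 1] by force
  then have lt: "j < 3" "k < 3" "j \<noteq> 0" "k \<noteq> 0" by (auto simp: doubleton_eq_iff)
  \<comment> \<open>The good at \<open>a\<close> lies outside \<open>P j\<close>, so opening the
    cycle there shows \<open>P j\<close> as an interval.\<close>
  have "good_at m a \<in> P 0" using P0[of a] ab by auto
  then have aj: "good_at m a \<notin> P j" using disj[of 0 j] lt by auto
  obtain b' c where bc: "a < b'" "b' < c" "c \<le> a + int m"
    and Pj: "\<And>t. a \<le> t \<Longrightarrow> t < a + int m \<Longrightarrow> good_at m t \<in> P j \<longleftrightarrow> b' \<le> t \<and> t < c"
    using bundle_positions_interval[OF bundle' m aj ne] lt by auto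
  have "b' \<le> b" "b < c" using Pj[of b] bj ab by auto
  moreover have "\<not> b' < b"
  proof
    assume "b' < b"
    then have "good_at m b' \<in> P 0" "good_at m b' \<in> P j" using P0[of b'] Pj[of b'] ab bc by auto
    then show False using disj[of 0 j] lt by auto
  qed
  ultimately have b': "b' = b" "b < c" by auto
  have Pj_arc: "P j = arc m b c"
  proof (intro equalityI subsetI)
    fix h assume h: "h \<in> P j"
    then obtain t where "a \<le> t" "t < a + int m" "good_at m t = h"
      using good_at_representative[OF m, of h a] sub[of j] lt by auto
    then show "h \<in> arc m b c" using Pj[of t] h b' by (auto simp: arc_def)
  next
    fix h assume "h \<in> arc m b c"
    then show "h \<in> P j" using Pj ab bc b' by (auto simp: arc_def)
  qed
  have "P k = {..<m} - P 0 - P j"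
  proof (intro equalityI subsetI)
    fix h assume "h \<in> P k"
    then show "h \<in> {..<m} - P 0 - P j" using sub[of k] disj[of k 0] disj[of k j] lt jk by auto
  next
    fix h assume "h \<in> {..<m} - P 0 - P j"
    then show "h \<in> P k" using n_split_3_cases[OF split, of h] jk by (auto simp: doubleton_eq_iff)
  qed
  also have "\<dots> = arc m c (a + int m)"
    using arcs_partition[OF m, of a b c] ab bc b' unfolding P0_arc Pj_arc by auto
  finally have "{arc m a b, arc m b c, arc m c (a + int m)} \<subseteq> P ` {..<3}"
    using P0_arc Pj_arc lt by auto
  then show thesis by (rule that[OF ab(2) b'(2) bc(3)])
qed

section \<open>From three arcs to a normalised utility\<close>

lemma sum_good_at:
  assumes "m > 0" "y \<le> x + int m"
  shows "(\<Sum>t\<in>{x..<y}. v (good_at m t)) = sum v (arc m x y)"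
  unfolding arc_def using inj_on_good_at[OF assms] by (simp add: sum.reindex)

lemma arc_full:
  assumes "m > 0"
  shows "arc m x (x + int m) = {..<m}"
  using arcs_partition(4)[OF assms, of x x x] by (simp add: arc_def)

text \<open>Dividing each good by the value of its own arc makes all three arcs worth exactly 1.
  Each arc is worth at least \<open>r\<close>, so \<open>r\<close> times the scaled utility stays at
  or below \<open>u\<close>.\<close>

lemma arcs_cut_value:
  fixes u :: "nat \<Rightarrow> real"
  assumes m: "m > 0" and nonneg: "\<And>g. g < m \<Longrightarrow> 0 \<le> u g" and "0 < r"
    and ord: "a \<le> b" "b \<le> c" "c \<le> a + int m"
    and big: "r \<le> sum u (arc m a b)" "r \<le> sum u (arc m b c)" "r \<le> sum u (arc m c (a + int m))"
  obtains F k where "cut_value (int m) F k"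
    "\<And>x y. x \<le> y \<Longrightarrow> y \<le> x + int m \<Longrightarrow> r * (F y - F x) \<le> sum u (arc m x y)"
proof -
  define A B C where "A = arc m a b" and "B = arc m b c" and "C = arc m c (a + int m)"
  note part = arcs_partition[OF m ord, folded A_def B_def C_def]
  note big' = big[folded A_def B_def C_def]
  define v where "v g = u g / sum u (if g \<in> A then A else if g \<in> B then B else C)" for g
  have "sum v A = (\<Sum>g\<in>A. u g / sum u A)"
    by (rule sum.cong) (auto simp: v_def)
  then have vA: "sum v A = 1"
    using big'(1) \<open>0 < r\<close> by (simp flip: sum_divide_distrib)
  have "sum v B = (\<Sum>g\<in>B. u g / sum u B)"
    using part(1) by (intro sum.cong) (auto simp: v_def)
  then have vB: "sum v B = 1"
    using big'(2) \<open>0 < r\<close> by (simp flip: sum_divide_distrib)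
  have "sum v C = (\<Sum>g\<in>C. u g / sum u C)"
    using part(2,3) by (intro sum.cong) (auto simp: v_def)
  then have vC: "sum v C = 1"
    using big'(3) \<open>0 < r\<close> by (simp flip: sum_divide_distrib)
  have v: "0 \<le> v g \<and> r * v g \<le> u g" if "g < m" for g
  proof -
    define S where "S = sum u (if g \<in> A then A else if g \<in> B then B else C)"
    have "r \<le> S" using big' by (simp add: S_def)
    have v_eq: "v g = u g / S" by (simp add: v_def S_def)
    show ?thesis
      unfolding v_eq using nonneg[OF that] \<open>0 < r\<close> \<open>r \<le> S\<close> mult_right_mono[of r S "u g"]
      by (auto simp: divide_le_eq mult.commute)
  qed
  \<comment> \<open>A signed prefix sum based at \<open>a\<close>: at least one of the two sums is
    empty.\<close>
  define F where "F x = (\<Sum>t\<in>{a..<x}. v (good_at m t)) - (\<Sum>t\<in>{x..<a}. v (good_at m t))" for x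
  have F_succ: "F (x + 1) = F x + v (good_at m x)" for x
  proof (cases "a \<le> x")
    case True
    then have "{a..<x + 1} = insert x {a..<x}" by auto
    then show ?thesis using True by (simp add: F_def)
  next
    case False
    then have "{x..<a} = insert x {x + 1..<a}" by auto
    then show ?thesis using False by (simp add: F_def)
  qed
  have F_diff: "F y = F x + (\<Sum>t\<in>{x..<y}. v (good_at m t))" if "x \<le> y" for x y
    using that
  proof (induction y rule: int_ge_induct)
    case (step y)
    then have "{x..<y + 1} = insert y {x..<y}" by auto
    then show ?case using step by (simp add: F_succ)
  qed simp
  have F_arc: "F y = F x + sum v (arc m x y)" if "x \<le> y" "y \<le> x + int m" for x y
    using F_diff[OF that(1)] sum_good_at[OF m that(2)] by simp
  have fin: "finite A" "finite B" "finite C" by (auto simp: A_def B_def C_def arc_def)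
  have "sum v {..<m} = sum v A + sum v B + sum v C"
    unfolding part(4)[symmetric] using fin part(1-3)
    by (simp add: sum.union_disjoint Int_Un_distrib2)
  then have per: "F (x + int m) = F x + 3" for x
    using F_arc[of x "x + int m"] vA vB vC by (simp add: arc_full[OF m])
  \<comment> \<open>\<open>a\<close>, \<open>b\<close>, \<open>c\<close> are the cut points 0, 1, 2;
    whole turns give the others.\<close>
  define k where "k j = (if j mod 3 = 0 then a else if j mod 3 = 1 then b else c) + j div 3 * int m"
    for j :: int
  have "F a = 0" by (simp add: F_def)
  then have base: "F a = 0" "F b = 1" "F c = 2"
    using F_arc[of a b] F_arc[of b c] ord vA vB by (auto simp: A_def B_def)
  have "F (k j) = of_int j" for j
  proof -
    have "j mod 3 = 0 \<or> j mod 3 = 1 \<or> j mod 3 = 2" by presburger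
    then have "F (k j) = of_int (j mod 3) + 3 * of_int (j div 3)"
      using base by (auto simp: k_def value_shift[of F "int m", OF per])
    also have "\<dots> = of_int (j mod 3 + 3 * (j div 3))"
      by (simp only: of_int_add of_int_mult of_int_numeral)
    finally show ?thesis by simp
  qed
  moreover have "mono F"
    using F_diff v good_at_less[OF m] by (auto intro!: monoI sum_nonneg)
  moreover have "k (j + 3) = k j + int m" for j
    by (simp add: k_def algebra_simps)
  ultimately have "cut_value (int m) F k"
    using per by (simp add: cut_value_def)
  moreover have "r * (F y - F x) \<le> sum u (arc m x y)" if "x \<le> y" "y \<le> x + int m" for x y
    using F_arc[OF that] v good_at_less[OF m]
    by (auto simp: arc_def sum_distrib_left intro!: sum_mono)
  ultimately show thesis using that by blast
qed

section \<open>Maximin shares and the allocation\<close>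

text \<open>The second form serves the agents in the cyclic order 0, 2, 1.\<close>

lemma n_split_3_arcsI:
  assumes "m > 0" "x \<le> y" "y \<le> z" "z \<le> x + int m"
  shows "n_split 3 m ((!) [arc m x y, arc m y z, arc m z (x + int m)])"
    and "n_split 3 m ((!) [arc m x y, arc m z (x + int m), arc m y z])"
proof -
  note part = arcs_partition[OF assms]
  show "n_split 3 m ((!) [arc m x y, arc m y z, arc m z (x + int m)])"
    by (intro n_split_3I is_bundle_arc[OF assms(1)] part)
  have "arc m z (x + int m) \<inter> arc m y z = {}"
    using part(3) by (simp only: Int_commute)
  moreover have "arc m x y \<union> arc m z (x + int m) \<union> arc m y z = {..<m}"
    unfolding part(4)[symmetric] by (simp only: Un_ac)
  ultimately show "n_split 3 m ((!) [arc m x y, arc m z (x + int m), arc m y z])"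
    by (intro n_split_3I is_bundle_arc[OF assms(1)] part(1,2))
qed

lemma n_split_3_exists: "\<exists>P. n_split 3 m P"
proof (cases "m = 0")
  case True
  then have "n_split 3 m ((!) [{}, {}, {}])"
    by (intro n_split_3I) (auto simp: is_bundle_def)
  then show ?thesis by blast
next
  case False
  then show ?thesis using n_split_3_arcsI(1)[of m 0 0 0] by auto
qed

text \<open>Minima of splits are values of subsets of the finite set of goods, so the supremum is a
  maximum.\<close>

lemma mms_attained:
  obtains P where "n_split 3 m P" "\<And>i. i < 3 \<Longrightarrow> mms 3 m u \<le> sum u (P i)"
proof -
  define V where "V = {Min ((\<lambda>i. sum u (P i)) ` {..<3}) | P. n_split 3 m P}"
  have "V \<subseteq> sum u ` Pow {..<m}"
  proof
    fix w assume "w \<in> V"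
    then obtain P where P: "n_split 3 m P" "w = Min ((\<lambda>i. sum u (P i)) ` {..<3})"
      unfolding V_def by blast
    have "w \<in> (\<lambda>i. sum u (P i)) ` {..<3}"
      unfolding P(2) by (rule Min_in) (simp_all add: lessThan_empty_iff)
    then obtain i where "i < 3" "w = sum u (P i)" by auto
    moreover have "P i \<subseteq> {..<m}"
      using n_split_3_subset[OF P(1) \<open>i < 3\<close>] .
    ultimately show "w \<in> sum u ` Pow {..<m}" by blast
  qed
  then have "finite V" by (rule finite_subset) simp
  moreover have "V \<noteq> {}" using n_split_3_exists unfolding V_def by blast
  ultimately have "Sup V \<in> V" using cSup_eq_Max Max_in by metis
  then obtain P where P: "n_split 3 m P" "mms 3 m u = Min ((\<lambda>i. sum u (P i)) ` {..<3})"
    unfolding V_def mms_def by blast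
  show thesis
    by (rule that[OF P(1)]) (simp add: P(2) Min_le)
qed

text \<open>A positive share makes every bundle of an optimal split non-empty, so the split consists
  of three arcs.\<close>

lemma positive_mms_cut_value:
  assumes nonneg: "\<And>g. g < m \<Longrightarrow> 0 \<le> u g" and pos: "0 < mms 3 m u"
  obtains F k where "cut_value (int m) F k"
    "\<And>x y. x \<le> y \<Longrightarrow> y \<le> x + int m \<Longrightarrow> mms 3 m u * (F y - F x) \<le> sum u (arc m x y)"
proof -
  obtain P where P: "n_split 3 m P" "\<And>i. i < 3 \<Longrightarrow> mms 3 m u \<le> sum u (P i)"
    using mms_attained[of m u] by blast
  have ne: "P i \<noteq> {}" if "i < 3" for i
    using P(2)[OF that] pos by auto
  obtain a b c where abc: "a < b" "b < c" "c \<le> a + int m"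
    and arcs: "{arc m a b, arc m b c, arc m c (a + int m)} \<subseteq> P ` {..<3}"
    using n_split_3_arcs[OF P(1) ne] by blast
  have "mms 3 m u \<le> sum u S" if "S \<in> P ` {..<3}" for S
    using that P(2) by blast
  moreover have "m > 0" using abc by linarith
  ultimately show thesis
    using arcs_cut_value[of m u "mms 3 m u" a b c] that abc arcs nonneg pos by auto
qed

text \<open>An agent with maximin share 0 accepts every arc, so any cut points can stand in for its own.\<close>

lemma sufficient_cut_value:
  assumes nonneg: "\<And>g. g < m \<Longrightarrow> 0 \<le> u g" and m: "m > 0" and G: "cut_value (int m) G l"
  shows "\<exists>F k. cut_value (int m) F k \<and> (\<forall>x y. x \<le> y \<longrightarrow> y \<le> x + int m \<longrightarrow> 5/6 \<le> F y - F x \<longrightarrow>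
    5/6 * mms 3 m u \<le> sum u (arc m x y))"
proof (cases "0 < mms 3 m u")
  case True
  show ?thesis
  proof (rule positive_mms_cut_value[OF nonneg True])
    fix F k assume F: "cut_value (int m) F k"
      and le: "\<And>x y. x \<le> y \<Longrightarrow> y \<le> x + int m \<Longrightarrow> mms 3 m u * (F y - F x) \<le> sum u (arc m x y)"
    have "5/6 * mms 3 m u \<le> sum u (arc m x y)"
      if xy: "x \<le> y" "y \<le> x + int m" "5/6 \<le> F y - F x" for x y
    proof -
      have "mms 3 m u * (5/6) \<le> mms 3 m u * (F y - F x)"
        using True xy(3) by (intro mult_left_mono) simp_all
      then show ?thesis using le[OF xy(1,2)] by simp
    qed
    then show ?thesis using F by blast
  qed
next
  case False
  have "5/6 * mms 3 m u \<le> sum u (arc m x y)" for x y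
  proof -
    have "5/6 * mms 3 m u \<le> 0" using False by simp
    also have "0 \<le> sum u (arc m x y)"
      using nonneg good_at_less[OF m] by (auto simp: arc_def intro!: sum_nonneg)
    finally show ?thesis .
  qed
  then show ?thesis using G by blast
qed

theorem theorem4p12:
  fixes m :: nat and u :: "nat \<Rightarrow> nat \<Rightarrow> real"
  assumes "\<And>i g. i < 3 \<Longrightarrow> g < m \<Longrightarrow> u i g \<ge> 0"
  shows "\<exists>P. sufficient (5/6) 3 m u P"
proof (cases "\<exists>j<3. 0 < mms 3 m (u j)")
  case False
  \<comment> \<open>No share is positive here, so any split will do.\<close>
  obtain P where P: "n_split 3 m P" using n_split_3_exists by blast
  have "5/6 * mms 3 m (u i) \<le> sum (u i) (P i)" if "i < 3" for i
  proof -
    have "P i \<subseteq> {..<m}" using n_split_3_subset[OF P that] .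
    then have "0 \<le> sum (u i) (P i)" using assms[OF that] by (auto intro!: sum_nonneg)
    moreover have "mms 3 m (u i) \<le> 0" using False that by force
    ultimately show ?thesis by simp
  qed
  then show ?thesis using P unfolding sufficient_def by blast
next
  case True
  then obtain j where j: "j < 3" "0 < mms 3 m (u j)" by blast
  obtain Q where Q: "n_split 3 m Q" "\<And>i. i < 3 \<Longrightarrow> mms 3 m (u j) \<le> sum (u j) (Q i)"
    using mms_attained[of m "u j"] by blast
  \<comment> \<open>On an empty cycle all bundles are worth 0, against the positive share of agent
    \<open>j\<close>.\<close>
  have m: "m > 0"
  proof (rule ccontr)
    assume "\<not> m > 0"
    then have "Q 0 = {}" using n_split_3_subset[OF Q(1), of 0] by simp
    then show False using Q(2)[of 0] j(2) by simp
  qed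
  have nonneg: "\<And>g. g < m \<Longrightarrow> 0 \<le> u 0 g" "\<And>g. g < m \<Longrightarrow> 0 \<le> u 1 g"
    "\<And>g. g < m \<Longrightarrow> 0 \<le> u 2 g" "\<And>g. g < m \<Longrightarrow> 0 \<le> u j g"
    using assms j(1) by simp_all
  \<comment> \<open>Agent \<open>j\<close> supplies the cut points lent to agents with share
    0.\<close>
  have "\<exists>G l. cut_value (int m) G l"
    by (rule positive_mms_cut_value[of m "u j", OF nonneg(4) j(2)]) auto
  then obtain G l where G: "cut_value (int m) G l" by blast
  obtain F0 k0 where F0: "cut_value (int m) F0 k0" and enough0: "\<And>x y. x \<le> y \<Longrightarrow>
      y \<le> x + int m \<Longrightarrow> 5/6 \<le> F0 y - F0 x \<Longrightarrow> 5/6 * mms 3 m (u 0) \<le> sum (u 0) (arc m x y)"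
    using sufficient_cut_value[of m "u 0", OF nonneg(1) m G] by blast
  obtain F1 k1 where F1: "cut_value (int m) F1 k1" and enough1: "\<And>x y. x \<le> y \<Longrightarrow>
      y \<le> x + int m \<Longrightarrow> 5/6 \<le> F1 y - F1 x \<Longrightarrow> 5/6 * mms 3 m (u 1) \<le> sum (u 1) (arc m x y)"
    using sufficient_cut_value[of m "u 1", OF nonneg(2) m G] by blast
  obtain F2 k2 where F2: "cut_value (int m) F2 k2" and enough2: "\<And>x y. x \<le> y \<Longrightarrow>
      y \<le> x + int m \<Longrightarrow> 5/6 \<le> F2 y - F2 x \<Longrightarrow> 5/6 * mms 3 m (u 2) \<le> sum (u 2) (arc m x y)"
    using sufficient_cut_value[of m "u 2", OF nonneg(3) m G] by blast
  have "\<not> conflict (int m) F0 F1 F2"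
    using no_conflict[OF F0 F1 F2] .
  then consider "fair (int m) F0 F1 F2" | "fair (int m) F0 F2 F1"
    unfolding conflict_def by blast
  then show ?thesis
  proof cases
    case 1
    then obtain x y z where "x \<le> y" "y \<le> z" "z \<le> x + int m" "5/6 \<le> F0 y - F0 x"
      "5/6 \<le> F1 z - F1 y" "5/6 \<le> F2 (x + int m) - F2 z"
      unfolding fair_def by blast
    then have "sufficient (5/6) 3 m u ((!) [arc m x y, arc m y z, arc m z (x + int m)])"
      unfolding sufficient_def all_less_3 using n_split_3_arcsI(1)[OF m]
        enough0[of x y] enough1[of y z] enough2[of z "x + int m"] by simp
    then show ?thesis by blast
  next
    case 2
    then obtain x y z where "x \<le> y" "y \<le> z" "z \<le> x + int m" "5/6 \<le> F0 y - F0 x"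
      "5/6 \<le> F2 z - F2 y" "5/6 \<le> F1 (x + int m) - F1 z"
      unfolding fair_def by blast
    then have "sufficient (5/6) 3 m u ((!) [arc m x y, arc m z (x + int m), arc m y z])"
      unfolding sufficient_def all_less_3 using n_split_3_arcsI(2)[OF m]
        enough0[of x y] enough2[of y z] enough1[of z "x + int m"] by simp
    then show ?thesis by blast
  qed
qed

end
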